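(* Consider the regulator's problem (P) described in the context with independent interference $t(\alpha,u)=\alpha$. Let $0\le u_{\mathrm{bot}}\le u_{\mathrm{top}}\le v$ be the constants for which the optimal allocation rule is $a^\circ(\alpha,u)=1$ if $u\le\phi(\alpha)$ and $a^\circ(\alpha,u)=0$ if $u>\phi(\alpha)$, with $\phi(\alpha)=u_{\mathrm{top}}$ if $\alpha\ge v$, $\phi(\alpha)=\alpha-(v-u_{\mathrm{top}})$ if $u_{\mathrm{bot}}+v-u_{\mathrm{top}}<\alpha<v$, and $\phi(\alpha)=u_{\mathrm{bot}}$ if $\alpha\le u_{\mathrm{bot}}+v-u_{\mathrm{top}}$. Then the optimal inspection rule is $$c^\circ(\alpha,u)=\begin{cases}1,&\text{if }u_{\mathrm{bot}}<u<\psi(\alpha),\\0,&\text{otherwise},\end{cases}$$ where $$\psi(\alpha)=\begin{cases}u_{\mathrm{top}},&\text{if }\alpha\ge v,\\ \alpha-(v-u_{\mathrm{top}}),&\text{if }u_{\mathrm{bot}}+v-u_{\mathrm{top}}<\alpha<v,\\ 0,&\text{if }\alpha\le u_{\mathrm{bot}}+v-u_{\mathrm{top}}.\end{cases}$$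
   Context: Fix $\bar\alpha,\bar u>0$, $v>0$ and an inspection cost $K$. The types $\alpha\in[0,\bar\alpha]$ and $u\in[0,\bar u]$ are independent with densities $f$ on $[0,\bar\alpha]$ and $g$ on $[0,\bar u]$, positive and continuous on these intervals (zero outside), with c.d.f.s $F$ and $G$. Let $r(u):=\frac{1-G(u)}{g(u)}-u$, assumed to be decreasing in $u$. The function $t(\alpha,u)$ is the interference. Problem (P): over functions $a,c:[0,\bar\alpha]\times[0,\bar u]\to[0,1]$ ($a$ = probability of exclusive access of the incumbent, $c$ = probability of inspection), maximize $$\int_0^{\bar u} g(u)\int_0^{\bar\alpha} f(\alpha)\big(\min(v,t(\alpha,u))-u\big)a(\alpha,u)\,d\alpha\,du$$ subject to (budget) $\int_0^{\bar\alpha}f(\alpha)\int_0^{\bar u}g(u)r(u)a(\alpha,u)\,du\,d\alpha=K\int_0^{\bar u}g(u)\int_0^{\bar\alpha}f(\alpha)c(\alpha,u)\,d\alpha\,du$; $a(\alpha,u)-a(\alpha,u)c(\alpha,u)\le a(0,u)$ for all $\alpha,u$; $c(\alpha,u)\le a(\alpha,u)$ for all $\alpha,u$; $a(\alpha,u)\le a(\alpha,u')$ for all $\alpha$ and all $u\ge u'$; $a(0,u)\le a(\alpha,u)$ for all $\alpha,u$. $(a^\circ,c^\circ)$ denotes the optimal solution of (P). Standing assumption: $K>K_{\mathrm{low}}$, where (for $t(\alpha,u)=\alpha$) $$K_{\mathrm{low}}:=\frac{\int_0^v(1-F(u))(1-G(u)-ug(u))\,du}{\int_0^v(1-F(u)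)g(u)\,du}.$$
   Formalization: The inspection formula is proved almost everywhere for every optimal rule, and everywhere off the curve u = ψ(α) for some optimal rule; at points of that curve with u > u_bot the constraint a − ac ≤ a(0,u) forces inspection, so the formula as displayed with strict inequality is infeasible there. *)

theory Defs
  imports "HOL-Probability.Probability"
begin

definition type_density :: "real \<Rightarrow> (real \<Rightarrow> real) \<Rightarrow> bool" where
  "type_density b f \<longleftrightarrow>
     continuous_on {0..b} f \<and> (\<forall>x\<in>{0..b}. 0 < f x) \<and> (\<forall>x. x \<notin> {0..b} \<longrightarrow> f x = 0) \<and>
     prob_space (density lborel f)"

definition cdf_of_density :: "(real \<Rightarrow> real) \<Rightarrow> real \<Rightarrow> real" where
  "cdf_of_density f = cdf (density lborel f)"

text \<open>The virtual type \<open>r\<close>; meaningful only where \<open>g u > 0\<close>, i.e. for \<open>u\<close> in the support of \<open>g\<close>.\<close>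

definition virtual_type :: "(real \<Rightarrow> real) \<Rightarrow> real \<Rightarrow> real" where
  "virtual_type g u = (1 - cdf_of_density g u) / g u - u"

text \<open>Throughout, \<open>A\<close> and \<open>U\<close> are the upper ends of the intervals of the types \<open>\<alpha>\<close> and \<open>u\<close>.
  Rules are total functions on the reals of which only the values on \<open>{0..A} \<times> {0..U}\<close> are
  relevant: every constraint and every integral is restricted to that rectangle.\<close>

definition objective ::
  "real \<Rightarrow> real \<Rightarrow> real \<Rightarrow> (real \<Rightarrow> real) \<Rightarrow> (real \<Rightarrow> real) \<Rightarrow> (real \<Rightarrow> real \<Rightarrow> real) \<Rightarrow>
   (real \<Rightarrow> real \<Rightarrow> real) \<Rightarrow> real" where
  "objective A U v f g t a =
     (LINT u:{0..U}|lborel. g u *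
        (LINT \<alpha>:{0..A}|lborel. f \<alpha> * (min v (t \<alpha> u) - u) * a \<alpha> u))"

text \<open>Borel measurability on the rectangle is what makes the integrals meaningful
  (a non-integrable function has integral 0).\<close>

definition admissible_rule :: "real \<Rightarrow> real \<Rightarrow> (real \<Rightarrow> real \<Rightarrow> real) \<Rightarrow> bool" where
  "admissible_rule A U a \<longleftrightarrow>
     (\<forall>\<alpha>\<in>{0..A}. \<forall>u\<in>{0..U}. a \<alpha> u \<in> {0..1}) \<and>
     set_borel_measurable borel ({0..A} \<times> {0..U}) (\<lambda>(\<alpha>, u). a \<alpha> u)"

definition feasible ::
  "real \<Rightarrow> real \<Rightarrow> real \<Rightarrow> (real \<Rightarrow> real) \<Rightarrow> (real \<Rightarrow> real) \<Rightarrow>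
   (real \<Rightarrow> real \<Rightarrow> real) \<Rightarrow> (real \<Rightarrow> real \<Rightarrow> real) \<Rightarrow> bool" where
  "feasible A U K f g a c \<longleftrightarrow>
     admissible_rule A U a \<and> admissible_rule A U c \<and>
     (LINT \<alpha>:{0..A}|lborel. f \<alpha> * (LINT u:{0..U}|lborel. g u * virtual_type g u * a \<alpha> u)) =
       K * (LINT u:{0..U}|lborel. g u * (LINT \<alpha>:{0..A}|lborel. f \<alpha> * c \<alpha> u)) \<and>
     (\<forall>\<alpha>\<in>{0..A}. \<forall>u\<in>{0..U}. a \<alpha> u - a \<alpha> u * c \<alpha> u \<le> a 0 u) \<and>
     (\<forall>\<alpha>\<in>{0..A}. \<forall>u\<in>{0..U}. c \<alpha> u \<le> a \<alpha> u) \<and>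
     (\<forall>\<alpha>\<in>{0..A}. \<forall>u\<in>{0..U}. \<forall>u'\<in>{0..U}. u' \<le> u \<longrightarrow> a \<alpha> u \<le> a \<alpha> u') \<and>
     (\<forall>\<alpha>\<in>{0..A}. \<forall>u\<in>{0..U}. a 0 u \<le> a \<alpha> u)"

definition optimal ::
  "real \<Rightarrow> real \<Rightarrow> real \<Rightarrow> real \<Rightarrow> (real \<Rightarrow> real) \<Rightarrow> (real \<Rightarrow> real) \<Rightarrow> (real \<Rightarrow> real \<Rightarrow> real) \<Rightarrow>
   (real \<Rightarrow> real \<Rightarrow> real) \<Rightarrow> (real \<Rightarrow> real \<Rightarrow> real) \<Rightarrow> bool" where
  "optimal A U v K f g t a c \<longleftrightarrow>
     feasible A U K f g a c \<and>
     (\<forall>a' c'. feasible A U K f g a' c' \<longrightarrow> objective A U v f g t a' \<le> objective A U v f g t a)"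

definition K_low :: "real \<Rightarrow> (real \<Rightarrow> real) \<Rightarrow> (real \<Rightarrow> real) \<Rightarrow> real" where
  "K_low v f g =
     (LINT u:{0..v}|lborel. (1 - cdf_of_density f u) * (1 - cdf_of_density g u - u * g u)) /
     (LINT u:{0..v}|lborel. (1 - cdf_of_density f u) * g u)"

definition phi :: "real \<Rightarrow> real \<Rightarrow> real \<Rightarrow> real \<Rightarrow> real" where
  "phi v u_bot u_top \<alpha> =
     (if v \<le> \<alpha> then u_top
      else if u_bot + v - u_top < \<alpha> then \<alpha> - (v - u_top)
      else u_bot)"

definition psi :: "real \<Rightarrow> real \<Rightarrow> real \<Rightarrow> real \<Rightarrow> real" where
  "psi v u_bot u_top \<alpha> =
     (if v \<le> \<alpha> then u_top
      else if u_bot + v - u_top < \<alpha> then \<alpha> - (v - u_top)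
      else 0)"

definition allocation_rule :: "real \<Rightarrow> real \<Rightarrow> real \<Rightarrow> real \<Rightarrow> real \<Rightarrow> real" where
  "allocation_rule v u_bot u_top \<alpha> u = (if u \<le> phi v u_bot u_top \<alpha> then 1 else 0)"

text \<open>On the curve \<open>u = psi v u_bot u_top \<alpha>\<close> with \<open>u > u_bot\<close>, the constraint
  \<open>a \<alpha> u - a \<alpha> u * c \<alpha> u \<le> a 0 u\<close> forces \<open>c \<alpha> u = 1\<close> for the allocation rule above, whereas the
  strict inequality below gives 0. Moreover, for \<open>u \<le> u_bot\<close> the problem sees \<open>c\<close> only through an
  integral. So the optimal inspection rule is to be identified with this one up to null sets.\<close>

definition inspection_rule :: "real \<Rightarrow> real \<Rightarrow> real \<Rightarrow> real \<Rightarrow> real \<Rightarrow> real" where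
  "inspection_rule v u_bot u_top \<alpha> u = (if u_bot < u \<and> u < psi v u_bot u_top \<alpha> then 1 else 0)"

end

theory Submission
  imports Defs
begin

text \<open>The constraint \<open>a \<alpha> u - a \<alpha> u * c \<alpha> u \<le> a 0 u\<close> forces inspection of every type with
  \<open>\<phi> 0 < u \<le> \<phi> \<alpha>\<close>, and the budget determines the total amount of inspection because \<open>K > 0\<close>.
  If \<open>c\<close> inspected more than is forced, then the allocation could be implemented with money left
  over. Since \<open>K\<close> exceeds \<open>K_low\<close>, the first best \<open>u \<le> min v \<alpha>\<close> runs a deficit. Hence somewhere on the
  segment of thresholds from \<open>\<phi>\<close> to the first best the budget balances exactly, and the
  allocation there is strictly better, contradicting optimality.\<close>

section \<open>Type densities\<close>

lemma type_density_measurable: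
  assumes "type_density b f"
  shows "f \<in> borel_measurable borel"
proof -
  have "(\<lambda>x. indicator {0..b} x *\<^sub>R f x) \<in> borel_measurable borel"
    using assms by (intro borel_measurable_continuous_on_indicator) (auto simp: type_density_def)
  moreover have "(\<lambda>x. indicator {0..b} x *\<^sub>R f x) = f"
    using assms by (intro ext) (auto simp: type_density_def indicator_def)
  ultimately show ?thesis by simp
qed

lemma type_density_nonneg: "type_density b f \<Longrightarrow> 0 \<le> f x"
  unfolding type_density_def by (cases "x \<in> {0..b}") (auto simp: less_imp_le)

lemma type_density_pos_iff: "type_density b f \<Longrightarrow> 0 < f x \<longleftrightarrow> x \<in> {0..b}"
  unfolding type_density_def by (metis less_irrefl)

text \<open>The density is positive exactly on \<open>{0..b}\<close>, so its null sets are the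
  Lebesgue null sets of that interval. This carries results under the type distributions over to
  Lebesgue measure.\<close>

lemma AE_type_density_iff:
  assumes "type_density b f"
  shows "(AE x in density lborel f. P x) \<longleftrightarrow> (AE x in lborel. x \<in> {0..b} \<longrightarrow> P x)"
  using type_density_measurable[OF assms] type_density_pos_iff[OF assms]
  by (subst AE_density) auto

lemma AE_type_density_support:
  assumes "type_density b f"
  shows "AE x in density lborel f. x \<in> {0..b}"
  by (simp add: AE_type_density_iff[OF assms])

lemma AE_type_density_neq:
  assumes "type_density b f"
  shows "AE x in density lborel f. x \<noteq> y"
  using AE_lborel_singleton[of y] by (auto simp: AE_type_density_iff[OF assms])

text \<open>Every nondegenerate subinterval of the support has positive mass, so a property that
  holds almost surely has a witness in it.\<close>

lemma AE_type_density_obtain: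
  assumes "type_density b f" "AE x in density lborel f. P x" "0 \<le> l" "l < r" "r \<le> b"
  obtains x where "l < x" "x < r" "P x"
proof -
  have "\<exists>x. l < x \<and> x < r \<and> P x"
  proof (rule ccontr)
    assume no: "\<not> ?thesis"
    have "AE x in lborel. x \<in> {0..b} \<longrightarrow> P x"
      using assms(1,2) AE_type_density_iff by blast
    then have "AE x in lborel. x \<notin> {l<..<r}"
      by eventually_elim (use no assms in auto)
    then have "emeasure lborel {l<..<r} = 0"
      by (subst (asm) AE_iff_measurable[where N = "{l<..<r}"]) auto
    then show False using \<open>l < r\<close> by simp
  qed
  then show ?thesis using that by blast
qed

text \<open>Measurability is asked only of the product with the indicator, because rules may be
  arbitrary outside the rectangle of types.\<close>

lemma set_integral_type_density:
  assumes "type_density b f"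
    and "(\<lambda>x. indicator {0..b} x * h x) \<in> borel_measurable borel"
  shows "(LINT x:{0..b}|lborel. f x * h x) =
    (LINT x|density lborel f. indicator {0..b} x * h x)"
  using assms type_density_measurable[OF assms(1)] type_density_nonneg[OF assms(1)]
  by (subst integral_density)
     (auto simp: set_lebesgue_integral_def mult_ac intro!: Bochner_Integration.integral_cong)

lemma cdf_of_density_measurable:
  assumes "type_density b f"
  shows "cdf_of_density f \<in> borel_measurable borel"
proof -
  interpret prob_space "density lborel f" using assms by (simp add: type_density_def)
  interpret finite_borel_measure "density lborel f" by standard auto
  show ?thesis
    unfolding cdf_of_density_def
    by (intro borel_measurable_mono monoI cdf_nondecreasing)
qed

lemma cdf_of_density_bounds:
  assumes "type_density b f"
  shows "0 \<le> cdf_of_density f x" "cdf_of_density f x \<le> 1"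
proof -
  interpret prob_space "density lborel f" using assms by (simp add: type_density_def)
  show "0 \<le> cdf_of_density f x" "cdf_of_density f x \<le> 1"
    by (auto simp: cdf_of_density_def cdf_def)
qed

text \<open>A law with a density has no atoms, so the endpoint does not matter.\<close>

lemma measure_type_density_atLeast:
  assumes "type_density b f"
  shows "measure (density lborel f) {x..} = 1 - cdf_of_density f x"
proof -
  interpret prob_space "density lborel f" using assms by (simp add: type_density_def)
  have "prob {x..} = prob (space (density lborel f) - {..x})"
    using AE_type_density_neq[OF assms, of x] by (intro finite_measure_eq_AE) auto
  then show ?thesis
    by (simp add: prob_compl cdf_of_density_def cdf_def del: space_density)
qed

lemma cdf_of_density_eq_1:
  assumes "type_density b f" "b \<le> x"
  shows "cdf_of_density f x = 1"
proof -
  interpret prob_space "density lborel f" using assms by (simp add: type_density_def)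
  have "AE y in density lborel f. y \<in> {..x}"
    using AE_type_density_support[OF assms(1)] by eventually_elim (use assms in auto)
  then show ?thesis
    by (subst (asm) AE_in_set_eq_1) (auto simp: cdf_of_density_def cdf_def)
qed

text \<open>In this form the fundamental theorem of calculus applies to the c.d.f.\<close>

lemma cdf_of_density_eq_integral:
  assumes "type_density b f" "x \<in> {0..b}"
  shows "cdf_of_density f x = integral {0..x} f"
proof -
  interpret prob_space "density lborel f" using assms by (simp add: type_density_def)
  note [measurable] = type_density_measurable[OF assms(1)]
  have cont: "continuous_on {0..x} f"
    using assms by (auto simp: type_density_def elim: continuous_on_subset)
  then have "set_integrable lborel {0..x} f" by (rule borel_integrable_atLeastAtMost')
  then have *: "(LINT y:{0..x}|lborel. f y) = integral {0..x} f"
    by (rule set_borel_integral_eq_integral)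
  have "cdf_of_density f x = (LINT y|density lborel f. indicator {..x} y)"
    by (simp add: cdf_of_density_def cdf_def)
  also have "\<dots> = (LINT y|lborel. f y * indicator {..x} y)"
    using type_density_nonneg[OF assms(1)] by (subst integral_density) auto
  also have "\<dots> = (LINT y:{0..x}|lborel. f y)"
    unfolding set_lebesgue_integral_def
    using assms by (intro Bochner_Integration.integral_cong) (auto simp: type_density_def indicator_def)
  finally show ?thesis using * by simp
qed

lemma density_times_virtual_type:
  assumes "type_density b g" "u \<in> {0..b}"
  shows "g u * virtual_type g u = 1 - cdf_of_density g u - u * g u"
  using type_density_pos_iff[OF assms(1), of u] assms(2)
  by (simp add: virtual_type_def field_simps)

lemma virtual_type_measurable:
  assumes "type_density b g"
  shows "virtual_type g \<in> borel_measurable borel"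
proof -
  note [measurable] = type_density_measurable[OF assms] cdf_of_density_measurable[OF assms]
  show ?thesis unfolding virtual_type_def by measurable
qed

text \<open>A continuous positive density attains a positive minimum on the compact interval, which
  bounds the quotient in \<open>virtual_type\<close>.\<close>

lemma virtual_type_bounded:
  assumes "type_density b g" "0 < b"
  obtains B where "\<forall>u\<in>{0..b}. \<bar>virtual_type g u\<bar> \<le> B"
proof -
  have "\<exists>x\<in>{0..b}. \<forall>y\<in>{0..b}. g x \<le> g y"
    using assms by (intro continuous_attains_inf) (auto simp: type_density_def)
  then obtain m where m: "m \<in> {0..b}" "\<And>y. y \<in> {0..b} \<Longrightarrow> g m \<le> g y" by blast
  have gm: "0 < g m" using type_density_pos_iff[OF assms(1)] m by blast
  have "\<bar>virtual_type g u\<bar> \<le> 1 / g m + b" if u: "u \<in> {0..b}" for u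
  proof -
    have "(1 - cdf_of_density g u) / g u \<le> 1 / g m"
      using m(2)[OF u] gm cdf_of_density_bounds[OF assms(1), of u] by (intro frac_le) auto
    moreover have "0 \<le> (1 - cdf_of_density g u) / g u"
      using m(2)[OF u] gm cdf_of_density_bounds[OF assms(1), of u] by simp
    ultimately show ?thesis using u by (auto simp: virtual_type_def abs_le_iff)
  qed
  then show ?thesis using that by blast
qed

text \<open>The integrand is the derivative of \<open>x * (1 - G x)\<close>, with \<open>G\<close>
  the c.d.f. of \<open>g\<close>: the revenue from the posted price \<open>x\<close>.\<close>

lemma virtual_type_integral:
  assumes "type_density b g" "x \<in> {0..b}"
  shows "(LINT u:{0..x}|lborel. g u * virtual_type g u) = x * (1 - cdf_of_density g x)"
proof -
  \<comment> \<open>\<open>H\<close> is the posted-price revenue with the c.d.f. written as an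
    integral, and \<open>h\<close> is its derivative.\<close>
  define H where "H y = y * (1 - integral {0..y} g)" for y
  define h where "h y = 1 - integral {0..y} g - y * g y" for y
  have cg: "continuous_on {0..x} g"
    using assms by (auto simp: type_density_def elim: continuous_on_subset)
  have deriv: "((\<lambda>y. integral {0..y} g) has_real_derivative g y) (at y within {0..x})"
    if "y \<in> {0..x}" for y
    using integral_has_vector_derivative[OF cg that]
    by (simp add: has_real_derivative_iff_has_vector_derivative)
  have "(h has_integral H x - H 0) {0..x}"
  proof (rule fundamental_theorem_of_calculus)
    show "0 \<le> x" using assms by simp
    fix y assume "y \<in> {0..x}"
    then have "(H has_real_derivative h y) (at y within {0..x})"
      unfolding H_def h_def by (auto intro!: derivative_eq_intros deriv)
    then show "(H has_vector_derivative h y) (at y within {0..x})"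
      by (simp add: has_real_derivative_iff_has_vector_derivative)
  qed
  then have int: "integral {0..x} h = x * (1 - cdf_of_density g x)"
    using cdf_of_density_eq_integral[OF assms] by (simp add: H_def integral_unique)
  have "continuous_on {0..x} h"
    unfolding h_def
    by (intro continuous_intros cg indefinite_integral_continuous_1 integrable_continuous_interval)
  then have "(LINT u:{0..x}|lborel. h u) = integral {0..x} h"
    by (intro set_borel_integral_eq_integral borel_integrable_atLeastAtMost')
  moreover have "(LINT u:{0..x}|lborel. g u * virtual_type g u) = (LINT u:{0..x}|lborel. h u)"
    using assms by (intro set_lebesgue_integral_cong)
      (auto simp: h_def density_times_virtual_type[OF assms(1)] cdf_of_density_eq_integral[OF assms(1)])
  ultimately show ?thesis using int by simp
qed

text \<open>Each section of the graph is a single point and hence null, so Fubini makes the graph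
  null.\<close>

lemma AE_pair_neq_graph:
  fixes M N :: "real measure"
  assumes "pair_sigma_finite M N" "sets M = sets borel" "sets N = sets borel"
    and "p \<in> borel_measurable borel" "\<And>x. AE y in N. y \<noteq> x"
  shows "AE z in M \<Otimes>\<^sub>M N. snd z \<noteq> (p (fst z) :: real)"
proof -
  interpret pair_sigma_finite M N by fact
  note [measurable] = assms(4) and [measurable_cong] = assms(2,3)
  have "AE z in M \<Otimes>\<^sub>M N. case z of (x, y) \<Rightarrow> y \<noteq> p x"
  proof (rule AE_pair_measure)
    show "{z \<in> space (M \<Otimes>\<^sub>M N). case z of (x, y) \<Rightarrow> y \<noteq> p x} \<in> sets (M \<Otimes>\<^sub>M N)"
      by measurable
    show "AE x in M. AE y in N. case (x, y) of (x, y) \<Rightarrow> y \<noteq> p x"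
      using assms(5) by simp
  qed
  then show ?thesis by eventually_elim auto
qed

section \<open>Threshold rules\<close>

text \<open>The threshold is an arbitrary function, because the segment from \<open>phi\<close> to
  the first best need not stay in the family given by \<open>u_bot\<close> and
  \<open>u_top\<close>.\<close>

definition threshold_rule :: "(real \<Rightarrow> real) \<Rightarrow> real \<Rightarrow> real \<Rightarrow> real" where
  "threshold_rule \<phi> \<alpha> u = (if u \<le> \<phi> \<alpha> then 1 else 0)"

text \<open>The least inspection that satisfies
  \<open>a \<alpha> u - a \<alpha> u * c \<alpha> u \<le> a 0 u\<close> for the allocation \<open>a = threshold_rule \<phi>\<close>.\<close>

definition threshold_inspection :: "(real \<Rightarrow> real) \<Rightarrow> real \<Rightarrow> real \<Rightarrow> real" where
  "threshold_inspection \<phi> \<alpha> u = (if \<phi> 0 < u \<and> u \<le> \<phi> \<alpha> then 1 else 0)"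

lemma threshold_measurable [measurable]:
  assumes [measurable]: "\<phi> \<in> borel_measurable borel"
  shows "(\<lambda>z. threshold_rule \<phi> (fst z) (snd z)) \<in> borel_measurable (borel \<Otimes>\<^sub>M borel)"
    and "(\<lambda>z. threshold_inspection \<phi> (fst z) (snd z)) \<in> borel_measurable (borel \<Otimes>\<^sub>M borel)"
  unfolding threshold_rule_def threshold_inspection_def by measurable

lemma threshold_rule_bounds: "0 \<le> threshold_rule \<phi> \<alpha> u" "threshold_rule \<phi> \<alpha> u \<le> 1"
  by (auto simp: threshold_rule_def)

lemma threshold_inspection_bounds:
  "0 \<le> threshold_inspection \<phi> \<alpha> u" "threshold_inspection \<phi> \<alpha> u \<le> 1"
  by (auto simp: threshold_inspection_def)

text \<open>Away from the limit a comparison with the sequence is eventually constant. The weak form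
  serves the upper threshold \<open>\<phi> \<alpha>\<close>, the strict one the lower bound
  \<open>\<phi> 0\<close> of inspection.\<close>

lemma tendsto_step:
  fixes x :: "nat \<Rightarrow> real"
  assumes "x \<longlonglongrightarrow> l" "u \<noteq> l"
  shows "\<forall>\<^sub>F n in sequentially. (u \<le> x n) = (u \<le> l)" "\<forall>\<^sub>F n in sequentially. (x n < u) = (l < u)"
proof -
  have "(\<forall>\<^sub>F n in sequentially. u < x n) \<or> (\<forall>\<^sub>F n in sequentially. x n < u)"
    using assms order_tendstoD[OF assms(1), of u] by (cases "u < l") auto
  with assms(2) show "\<forall>\<^sub>F n in sequentially. (u \<le> x n) = (u \<le> l)"
    "\<forall>\<^sub>F n in sequentially. (x n < u) = (l < u)"
    using order_tendstoD[OF assms(1), of u]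
    by (cases "u < l"; force elim!: eventually_mono)+
qed

section \<open>The joint distribution of the types and Fubini on the rectangle\<close>

locale regulator =
  fixes A U v :: real and f g :: "real \<Rightarrow> real"
  assumes A_pos: "0 < A" and U_pos: "0 < U" and v_pos: "0 < v"
    and f: "type_density A f" and g: "type_density U g"
begin

abbreviation "types \<equiv> density lborel f \<Otimes>\<^sub>M density lborel g"
abbreviation "rect \<equiv> {0..A} \<times> {0..U}"

lemmas [measurable] = type_density_measurable[OF f] type_density_measurable[OF g]
  virtual_type_measurable[OF g] cdf_of_density_measurable[OF f] cdf_of_density_measurable[OF g]

sublocale incumbent: prob_space "density lborel f"
  using f by (simp add: type_density_def)

sublocale entrant: prob_space "density lborel g"
  using g by (simp add: type_density_def)

sublocale pair: pair_prob_space "density lborel f" "density lborel g" ..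

lemma sets_types [measurable_cong]: "sets types = sets (borel \<Otimes>\<^sub>M borel)"
  by (intro sets_pair_measure_cong) auto

lemma rect_sets [measurable]: "rect \<in> sets (borel \<Otimes>\<^sub>M borel)"
  by (intro pair_measureI) auto

text \<open>Both sides reduce to a statement about sections, where the equivalence for a single
  density applies in each coordinate.\<close>

lemma AE_types_iff:
  assumes [measurable]: "Measurable.pred (borel \<Otimes>\<^sub>M borel) Q"
  shows "(AE z in types. Q z) \<longleftrightarrow> (AE z in lborel. z \<in> rect \<longrightarrow> Q z)"
proof -
  have 1: "{z \<in> space types. Q (fst z, snd z)} \<in> sets types" by measurable
  have "{z \<in> space (lborel \<Otimes>\<^sub>M lborel). fst z \<in> {0..A} \<and> snd z \<in> {0..U} \<longrightarrow> Q (fst z, snd z)}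
      \<in> sets (lborel \<Otimes>\<^sub>M lborel)" by measurable
  note 2 = lborel_pair.AE_pair_iff[OF this]
  have "(AE z in types. Q z) \<longleftrightarrow> (AE \<alpha> in density lborel f. AE u in density lborel g. Q (\<alpha>, u))"
    using pair.AE_pair_iff[OF 1] by simp
  also have "\<dots> \<longleftrightarrow> (AE \<alpha> in lborel. AE u in lborel. \<alpha> \<in> {0..A} \<and> u \<in> {0..U} \<longrightarrow> Q (\<alpha>, u))"
    unfolding AE_type_density_iff[OF f] AE_type_density_iff[OF g]
    by (intro arg_cong[where f = "\<lambda>P. almost_everywhere lborel P"] ext) auto
  also have "\<dots> \<longleftrightarrow> (AE z in lborel \<Otimes>\<^sub>M lborel. z \<in> rect \<longrightarrow> Q z)"
    unfolding 2 by (auto simp: mem_Times_iff)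
  finally show ?thesis unfolding lborel_prod .
qed

lemma AE_types_neq_graph:
  assumes "p \<in> borel_measurable borel"
  shows "AE z in types. snd z \<noteq> p (fst z)"
  by (intro AE_pair_neq_graph AE_type_density_neq[OF g] assms pair.pair_sigma_finite_axioms) auto

lemma AE_types_rect: "AE z in types. z \<in> rect"
  by (subst AE_types_iff) auto

lemma set_integrable_rect:
  fixes h :: "real \<times> real \<Rightarrow> real"
  assumes "set_borel_measurable (borel \<Otimes>\<^sub>M borel) rect h" "\<forall>z\<in>rect. \<bar>h z\<bar> \<le> B"
  shows "set_integrable types rect h"
proof -
  have [measurable]: "(\<lambda>z. indicator rect z *\<^sub>R h z) \<in> borel_measurable (borel \<Otimes>\<^sub>M borel)"
    using assms(1) by (simp add: set_borel_measurable_def)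
  show ?thesis
    unfolding set_integrable_def
  proof (rule pair.P.integrable_const_bound[where B = B])
    show "AE z in types. norm (indicator rect z *\<^sub>R h z) \<le> B"
      using AE_types_rect by eventually_elim (use assms(2) in auto)
  qed measurable
qed

text \<open>Both orders are provided because problem (P) integrates revenue first over
  \<open>u\<close>, but surplus and inspection first over \<open>\<alpha>\<close>.\<close>

lemma iterated_integral:
  fixes h :: "real \<times> real \<Rightarrow> real"
  assumes "set_borel_measurable (borel \<Otimes>\<^sub>M borel) rect h" "\<forall>z\<in>rect. \<bar>h z\<bar> \<le> B"
  shows "(LINT \<alpha>:{0..A}|lborel. f \<alpha> * (LINT u:{0..U}|lborel. g u * h (\<alpha>, u))) =
      (LINT z:rect|types. h z)"
    and "(LINT u:{0..U}|lborel. g u * (LINT \<alpha>:{0..A}|lborel. f \<alpha> * h (\<alpha>, u))) =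
      (LINT z:rect|types. h z)"
proof -
  \<comment> \<open>Extension by zero turns measurability on the rectangle into measurability on the
    plane, and lets the outer indicators be dropped afterwards.\<close>
  define H where "H \<alpha> u = indicator rect (\<alpha>, u) * h (\<alpha>, u)" for \<alpha> u
  have H_0: "H \<alpha> = (\<lambda>_. 0)" if "\<alpha> \<notin> {0..A}" for \<alpha>
    using that by (auto simp: H_def)
  have H_0': "(\<lambda>\<alpha>. H \<alpha> u) = (\<lambda>_. 0)" if "u \<notin> {0..U}" for u
    using that by (auto simp: H_def)
  have H_eq: "case_prod H = (\<lambda>z. indicator rect z *\<^sub>R h z)"
    by (auto simp: H_def)
  have meas: "case_prod H \<in> borel_measurable (borel \<Otimes>\<^sub>M borel)"
    using assms(1) by (simp add: set_borel_measurable_def H_eq)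
  then have [measurable]: "(\<lambda>u. H \<alpha> u) \<in> borel_measurable borel"
    "(\<lambda>\<alpha>. H \<alpha> u) \<in> borel_measurable borel" for \<alpha> u
    by (auto dest: measurable_Pair2[of _ _ _ _ \<alpha>] measurable_Pair1[of _ _ _ _ u])
  have meas': "case_prod H \<in> borel_measurable (borel \<Otimes>\<^sub>M density lborel g)"
     "(\<lambda>(u, \<alpha>). H \<alpha> u) \<in> borel_measurable (borel \<Otimes>\<^sub>M density lborel f)"
    using meas measurable_pair_swap[OF meas]
    by (simp_all cong: measurable_cong_sets sets_pair_measure_cong)
  have int: "integrable types (case_prod H)"
    using set_integrable_rect[OF assms] by (simp add: set_integrable_def H_eq)
  have eq: "(LINT z:rect|types. h z) = integral\<^sup>L types (case_prod H)"
    by (simp add: set_lebesgue_integral_def H_eq)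
  have 1: "(LINT u:{0..U}|lborel. g u * h (\<alpha>, u)) = (LINT u|density lborel g. H \<alpha> u)"
    if "\<alpha> \<in> {0..A}" for \<alpha>
  proof -
    have "(\<lambda>u. indicator {0..U} u * h (\<alpha>, u)) = H \<alpha>"
      using that by (auto simp: H_def indicator_def)
    then show ?thesis using set_integral_type_density[OF g, of "\<lambda>u. h (\<alpha>, u)"] by simp
  qed
  have 2: "(LINT \<alpha>:{0..A}|lborel. f \<alpha> * h (\<alpha>, u)) = (LINT \<alpha>|density lborel f. H \<alpha> u)"
    if "u \<in> {0..U}" for u
  proof -
    have "(\<lambda>\<alpha>. indicator {0..A} \<alpha> * h (\<alpha>, u)) = (\<lambda>\<alpha>. H \<alpha> u)"
      using that by (auto simp: H_def indicator_def)
    then show ?thesis using set_integral_type_density[OF f, of "\<lambda>\<alpha>. h (\<alpha>, u)"] by simp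
  qed
  have "(LINT \<alpha>:{0..A}|lborel. f \<alpha> * (LINT u:{0..U}|lborel. g u * h (\<alpha>, u))) =
      (LINT \<alpha>:{0..A}|lborel. f \<alpha> * (LINT u|density lborel g. H \<alpha> u))"
    by (intro set_lebesgue_integral_cong) (auto simp: 1)
  also have "\<dots> = (LINT \<alpha>|density lborel f. indicator {0..A} \<alpha> * (LINT u|density lborel g. H \<alpha> u))"
    using meas' by (intro set_integral_type_density[OF f] borel_measurable_times
      entrant.borel_measurable_lebesgue_integral) auto
  also have "\<dots> = (LINT \<alpha>|density lborel f. LINT u|density lborel g. H \<alpha> u)"
    using H_0 by (intro Bochner_Integration.integral_cong refl) (simp split: split_indicator)
  finally show "(LINT \<alpha>:{0..A}|lborel. f \<alpha> * (LINT u:{0..U}|lborel. g u * h (\<alpha>, u))) =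
      (LINT z:rect|types. h z)"
    using pair.integral_fst[OF int] eq by simp
  have "(LINT u:{0..U}|lborel. g u * (LINT \<alpha>:{0..A}|lborel. f \<alpha> * h (\<alpha>, u))) =
      (LINT u:{0..U}|lborel. g u * (LINT \<alpha>|density lborel f. H \<alpha> u))"
    by (intro set_lebesgue_integral_cong) (auto simp: 2)
  also have "\<dots> = (LINT u|density lborel g. indicator {0..U} u * (LINT \<alpha>|density lborel f. H \<alpha> u))"
    using meas' by (intro set_integral_type_density[OF g] borel_measurable_times
      incumbent.borel_measurable_lebesgue_integral) auto
  also have "\<dots> = (LINT u|density lborel g. LINT \<alpha>|density lborel f. H \<alpha> u)"
    using H_0' by (intro Bochner_Integration.integral_cong refl) (simp split: split_indicator)
  finally show "(LINT u:{0..U}|lborel. g u * (LINT \<alpha>:{0..A}|lborel. f \<alpha> * h (\<alpha>, u))) =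
      (LINT z:rect|types. h z)"
    using pair.integral_snd[OF int] eq by simp
qed

lemma set_borel_measurable_rect:
  fixes h :: "real \<times> real \<Rightarrow> real"
  assumes [measurable]: "h \<in> borel_measurable (borel \<Otimes>\<^sub>M borel)"
  shows "set_borel_measurable (borel \<Otimes>\<^sub>M borel) rect h"
  unfolding set_borel_measurable_def by measurable

section \<open>The terms of problem (P) as integrals over the rectangle\<close>

lemma admissible_rule_iff:
  "admissible_rule A U a \<longleftrightarrow> (\<forall>\<alpha>\<in>{0..A}. \<forall>u\<in>{0..U}. a \<alpha> u \<in> {0..1}) \<and>
    set_borel_measurable (borel \<Otimes>\<^sub>M borel) rect (\<lambda>z. a (fst z) (snd z))"
  by (simp add: admissible_rule_def borel_prod case_prod_beta')

text \<open>All integrands of (P) are a bounded weight times a rule; the weights are the surplus,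
  the virtual type and the constant 1.\<close>

lemma admissible_times:
  fixes h :: "real \<times> real \<Rightarrow> real"
  assumes "admissible_rule A U a" and [measurable]: "h \<in> borel_measurable (borel \<Otimes>\<^sub>M borel)"
    and "\<forall>z\<in>rect. \<bar>h z\<bar> \<le> B"
  shows "set_borel_measurable (borel \<Otimes>\<^sub>M borel) rect (\<lambda>z. h z * a (fst z) (snd z))"
    and "\<forall>z\<in>rect. \<bar>h z * a (fst z) (snd z)\<bar> \<le> B"
proof -
  have [measurable]: "(\<lambda>z. indicator rect z *\<^sub>R a (fst z) (snd z)) \<in> borel_measurable (borel \<Otimes>\<^sub>M borel)"
    using assms(1) by (simp add: admissible_rule_iff set_borel_measurable_def)
  have "(\<lambda>z. h z * (indicator rect z *\<^sub>R a (fst z) (snd z))) \<in> borel_measurable (borel \<Otimes>\<^sub>M borel)"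
    by measurable
  then show "set_borel_measurable (borel \<Otimes>\<^sub>M borel) rect (\<lambda>z. h z * a (fst z) (snd z))"
    by (simp add: set_borel_measurable_def mult.left_commute)
  show "\<forall>z\<in>rect. \<bar>h z * a (fst z) (snd z)\<bar> \<le> B"
  proof
    fix z assume z: "z \<in> rect"
    then have "\<bar>a (fst z) (snd z)\<bar> \<le> 1"
      using assms(1) by (auto simp: admissible_rule_iff mem_Times_iff)
    then have "\<bar>h z\<bar> * \<bar>a (fst z) (snd z)\<bar> \<le> \<bar>h z\<bar>"
      by (simp add: mult_left_le)
    then show "\<bar>h z * a (fst z) (snd z)\<bar> \<le> B"
      using assms(3) z by (simp only: abs_mult) (meson order_trans)
  qed
qed

lemma virtual_type_bound:
  obtains B where "\<forall>z\<in>rect. \<bar>virtual_type g (snd z)\<bar> \<le> B"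
proof -
  obtain B where "\<forall>u\<in>{0..U}. \<bar>virtual_type g u\<bar> \<le> B"
    using virtual_type_bounded[OF g U_pos] by metis
  then show ?thesis using that[of B] by (simp add: mem_Times_iff)
qed

lemma surplus_bound: "\<forall>z\<in>rect. \<bar>min v (fst z) - snd z\<bar> \<le> v + A + U"
  using v_pos by auto

lemma objective_eq:
  assumes "admissible_rule A U a"
  shows "objective A U v f g (\<lambda>\<alpha> u. \<alpha>) a =
    (LINT z:rect|types. (min v (fst z) - snd z) * a (fst z) (snd z))"
proof -
  have "(LINT u:{0..U}|lborel. g u * (LINT \<alpha>:{0..A}|lborel. f \<alpha> * ((min v \<alpha> - u) * a \<alpha> u))) =
      (LINT z:rect|types. (min v (fst z) - snd z) * a (fst z) (snd z))"
    using iterated_integral(2)[OF admissible_times[OF assms _ surplus_bound]] by simp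
  then show ?thesis by (simp only: objective_def mult.assoc)
qed

lemma revenue_eq:
  assumes "admissible_rule A U a"
  shows "(LINT \<alpha>:{0..A}|lborel. f \<alpha> * (LINT u:{0..U}|lborel. g u * virtual_type g u * a \<alpha> u)) =
    (LINT z:rect|types. virtual_type g (snd z) * a (fst z) (snd z))"
proof -
  obtain B where B: "\<forall>z\<in>rect. \<bar>virtual_type g (snd z)\<bar> \<le> B"
    using virtual_type_bound by metis
  note iterated_integral(1)[OF admissible_times[OF assms _ B]]
  then have "(LINT \<alpha>:{0..A}|lborel. f \<alpha> * (LINT u:{0..U}|lborel. g u * (virtual_type g u * a \<alpha> u))) =
      (LINT z:rect|types. virtual_type g (snd z) * a (fst z) (snd z))" by simp
  then show ?thesis by (simp only: mult.assoc)
qed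

lemma inspection_eq:
  assumes "admissible_rule A U c"
  shows "(LINT u:{0..U}|lborel. g u * (LINT \<alpha>:{0..A}|lborel. f \<alpha> * c \<alpha> u)) =
    (LINT z:rect|types. c (fst z) (snd z))"
  using iterated_integral(2)[OF admissible_times[OF assms, of "\<lambda>_. 1" 1]] by simp

section \<open>Net revenue and feasibility of threshold rules\<close>

lemma admissible_threshold:
  assumes "\<phi> \<in> borel_measurable borel"
  shows "admissible_rule A U (threshold_rule \<phi>)" "admissible_rule A U (threshold_inspection \<phi>)"
  unfolding admissible_rule_iff
  by (intro conjI ballI set_borel_measurable_rect threshold_measurable assms;
      simp add: threshold_rule_bounds threshold_inspection_bounds)+

lemma admissible_set_integrable:
  assumes "admissible_rule A U a"
  shows "set_integrable types rect (\<lambda>z. a (fst z) (snd z))"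
    and "set_integrable types rect (\<lambda>z. (min v (fst z) - snd z) * a (fst z) (snd z))"
    and "set_integrable types rect (\<lambda>z. virtual_type g (snd z) * a (fst z) (snd z))"
proof -
  show "set_integrable types rect (\<lambda>z. a (fst z) (snd z))"
    using set_integrable_rect[OF admissible_times[OF assms, of "\<lambda>_. 1" 1]] by simp
  show "set_integrable types rect (\<lambda>z. (min v (fst z) - snd z) * a (fst z) (snd z))"
    by (rule set_integrable_rect[OF admissible_times[OF assms _ surplus_bound]]) auto
  obtain B where B: "\<forall>z\<in>rect. \<bar>virtual_type g (snd z)\<bar> \<le> B"
    using virtual_type_bound by metis
  show "set_integrable types rect (\<lambda>z. virtual_type g (snd z) * a (fst z) (snd z))"
    by (rule set_integrable_rect[OF admissible_times[OF assms _ B]]) auto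
qed

text \<open>This is the money left in the budget when only the forced inspection is carried out; the
  budget constraint says that it is 0.\<close>

definition net_revenue :: "real \<Rightarrow> (real \<Rightarrow> real) \<Rightarrow> real" where
  "net_revenue K \<phi> =
    (LINT z:rect|types. virtual_type g (snd z) * threshold_rule \<phi> (fst z) (snd z)) -
    K * (LINT z:rect|types. threshold_inspection \<phi> (fst z) (snd z))"

text \<open>Inspection is certain wherever the allocation exceeds the one at
  \<open>\<alpha> = 0\<close>, and a threshold rule is decreasing in \<open>u\<close>, so only the
  budget and the minimality of \<open>\<phi> 0\<close> need assumptions.\<close>

lemma feasible_threshold:
  assumes "\<phi> \<in> borel_measurable borel" "\<And>\<alpha>. \<alpha> \<in> {0..A} \<Longrightarrow> \<phi> 0 \<le> \<phi> \<alpha>" "net_revenue K \<phi> = 0"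
  shows "feasible A U K f g (threshold_rule \<phi>) (threshold_inspection \<phi>)"
  unfolding feasible_def revenue_eq[OF admissible_threshold(1)[OF assms(1)]]
    inspection_eq[OF admissible_threshold(2)[OF assms(1)]]
  using assms(2,3) admissible_threshold[OF assms(1)]
  by (force simp: net_revenue_def threshold_rule_def threshold_inspection_def)

text \<open>Equality at 0 is a separate assumption: inspection depends on the single value
  \<open>\<phi> 0\<close>, which almost sure equality of the allocations does not control.\<close>

lemma net_revenue_cong:
  assumes [measurable]: "\<phi> \<in> borel_measurable borel" "\<phi>' \<in> borel_measurable borel"
    and "\<phi> 0 = \<phi>' 0"
    and "AE z in types. threshold_rule \<phi> (fst z) (snd z) = threshold_rule \<phi>' (fst z) (snd z)"
  shows "net_revenue K \<phi> = net_revenue K \<phi>'"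
proof -
  have "AE z in types. threshold_inspection \<phi> (fst z) (snd z) = threshold_inspection \<phi>' (fst z) (snd z)"
    using assms(4) by eventually_elim
      (use assms(3) in \<open>auto simp: threshold_rule_def threshold_inspection_def split: if_splits\<close>)
  then have "(LINT z:rect|types. threshold_inspection \<phi> (fst z) (snd z)) =
      (LINT z:rect|types. threshold_inspection \<phi>' (fst z) (snd z))"
    unfolding set_lebesgue_integral_def by (intro integral_cong_AE) auto
  moreover have "(LINT z:rect|types. virtual_type g (snd z) * threshold_rule \<phi> (fst z) (snd z)) =
      (LINT z:rect|types. virtual_type g (snd z) * threshold_rule \<phi>' (fst z) (snd z))"
    unfolding set_lebesgue_integral_def using assms(4) by (intro integral_cong_AE) auto
  ultimately show ?thesis by (simp add: net_revenue_def)
qed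

lemma net_revenue_path_continuous:
  assumes [measurable]: "\<phi> \<in> borel_measurable borel" "\<phi>' \<in> borel_measurable borel"
  shows "continuous_on S (\<lambda>s. net_revenue K (\<lambda>\<alpha>. (1 - s) * \<phi> \<alpha> + s * \<phi>' \<alpha>))"
proof (rule continuous_on_sequentiallyI)
  fix s :: "nat \<Rightarrow> real" and l assume s: "s \<longlonglongrightarrow> l"
  define p where "p s = (\<lambda>\<alpha>. (1 - s) * \<phi> \<alpha> + s * \<phi>' \<alpha>)" for s
  have [measurable]: "p s \<in> borel_measurable borel" for s by (simp add: p_def)
  have p: "(\<lambda>n. p (s n) \<alpha>) \<longlonglongrightarrow> p l \<alpha>" for \<alpha>
    unfolding p_def by (intro tendsto_intros s)
  obtain B where B: "\<forall>u\<in>{0..U}. \<bar>virtual_type g u\<bar> \<le> B"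
    using virtual_type_bounded[OF g U_pos] by metis
  \<comment> \<open>In the limit the integrands can jump only on the graph of \<open>p l\<close> and
    on the level \<open>p l 0\<close>, both null; elsewhere \<open>tendsto_step\<close> gives
    pointwise convergence and dominated convergence applies.\<close>
  have ae: "AE z in types. z \<in> rect \<and> snd z \<noteq> p l (fst z) \<and> snd z \<noteq> p l 0"
    using AE_types_rect AE_types_neq_graph[of "p l"] AE_types_neq_graph[of "\<lambda>_. p l 0"] by auto
  have "(\<lambda>n. LINT z:rect|types. virtual_type g (snd z) * threshold_rule (p (s n)) (fst z) (snd z))
     \<longlonglongrightarrow> (LINT z:rect|types. virtual_type g (snd z) * threshold_rule (p l) (fst z) (snd z))"
    unfolding set_lebesgue_integral_def
  proof (rule integral_dominated_convergence[where w = "\<lambda>_. B"])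
    show "AE z in types. (\<lambda>n. indicator rect z *\<^sub>R (virtual_type g (snd z) * threshold_rule (p (s n)) (fst z) (snd z)))
      \<longlonglongrightarrow> indicator rect z *\<^sub>R (virtual_type g (snd z) * threshold_rule (p l) (fst z) (snd z))"
      using ae
    proof eventually_elim
      fix z assume z: "z \<in> rect \<and> snd z \<noteq> p l (fst z) \<and> snd z \<noteq> p l 0"
      then have "\<forall>\<^sub>F n in sequentially. (snd z \<le> p (s n) (fst z)) = (snd z \<le> p l (fst z))"
        using tendsto_step[OF p] by blast
      then show "(\<lambda>n. indicator rect z *\<^sub>R (virtual_type g (snd z) * threshold_rule (p (s n)) (fst z) (snd z)))
        \<longlonglongrightarrow> indicator rect z *\<^sub>R (virtual_type g (snd z) * threshold_rule (p l) (fst z) (snd z))"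
        by (intro tendsto_eventually) (auto simp: threshold_rule_def elim!: eventually_mono)
    qed
    show "AE z in types. norm (indicator rect z *\<^sub>R (virtual_type g (snd z) *
        threshold_rule (p (s n)) (fst z) (snd z))) \<le> B" for n
      using AE_types_rect
    proof eventually_elim
      fix z assume "z \<in> rect"
      then show "norm (indicator rect z *\<^sub>R (virtual_type g (snd z) *
        threshold_rule (p (s n)) (fst z) (snd z))) \<le> B"
        using B by (auto simp: threshold_rule_def)
    qed
  qed auto
  moreover have "(\<lambda>n. LINT z:rect|types. threshold_inspection (p (s n)) (fst z) (snd z))
     \<longlonglongrightarrow> (LINT z:rect|types. threshold_inspection (p l) (fst z) (snd z))"
    unfolding set_lebesgue_integral_def
  proof (rule integral_dominated_convergence[where w = "\<lambda>_. 1"])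
    show "AE z in types. (\<lambda>n. indicator rect z *\<^sub>R threshold_inspection (p (s n)) (fst z) (snd z))
      \<longlonglongrightarrow> indicator rect z *\<^sub>R threshold_inspection (p l) (fst z) (snd z)"
      using ae
    proof eventually_elim
      fix z assume z: "z \<in> rect \<and> snd z \<noteq> p l (fst z) \<and> snd z \<noteq> p l 0"
      then have "\<forall>\<^sub>F n in sequentially. (snd z \<le> p (s n) (fst z)) = (snd z \<le> p l (fst z))"
        "\<forall>\<^sub>F n in sequentially. (p (s n) 0 < snd z) = (p l 0 < snd z)"
        using tendsto_step[OF p] by blast+
      then show "(\<lambda>n. indicator rect z *\<^sub>R threshold_inspection (p (s n)) (fst z) (snd z))
        \<longlonglongrightarrow> indicator rect z *\<^sub>R threshold_inspection (p l) (fst z) (snd z)"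
        by (intro tendsto_eventually, eventually_elim) (auto simp: threshold_inspection_def)
    qed
  qed (auto simp: threshold_inspection_def)
  ultimately show "(\<lambda>n. net_revenue K (\<lambda>\<alpha>. (1 - s n) * \<phi> \<alpha> + s n * \<phi>' \<alpha>))
      \<longlonglongrightarrow> net_revenue K (\<lambda>\<alpha>. (1 - l) * \<phi> \<alpha> + l * \<phi>' \<alpha>)"
    unfolding net_revenue_def p_def by (intro tendsto_intros)
qed

section \<open>The first best and improvement towards it\<close>

text \<open>The cut at \<open>U\<close> keeps the threshold in \<open>{0..U}\<close> and leaves the
  allocation on the rectangle as it is for \<open>min v \<alpha>\<close>.\<close>

definition first_best :: "real \<Rightarrow> real" where
  "first_best \<alpha> = min U (min v \<alpha>)"

lemma first_best_measurable [measurable]: "first_best \<in> borel_measurable borel"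
  unfolding first_best_def by measurable

lemma first_best_0 [simp]: "first_best 0 = 0"
  using U_pos v_pos by (simp add: first_best_def)

text \<open>Integrating over \<open>\<alpha>\<close> first, a type \<open>u \<le> v\<close> is
  allocated exactly when \<open>\<alpha> \<ge> u\<close>, which has probability
  \<open>1 - cdf_of_density f u\<close>. The cases \<open>h = 1\<close> and
  \<open>h = virtual_type g\<close> give the two integrals of \<open>K_low\<close>.\<close>

lemma first_best_integral:
  fixes h :: "real \<Rightarrow> real"
  assumes [measurable]: "h \<in> borel_measurable borel"
    and h: "\<forall>u\<in>{0..U}. \<bar>h u\<bar> \<le> B"
  shows "(LINT z:rect|types. h (snd z) * threshold_rule first_best (fst z) (snd z)) =
    (LINT u:{0..v}|lborel. (1 - cdf_of_density f u) * (g u * h u))"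
proof -
  have bd: "\<forall>z\<in>rect. \<bar>h (snd z)\<bar> \<le> B"
    using h by (auto simp: mem_Times_iff)
  have inner: "(LINT \<alpha>:{0..A}|lborel. f \<alpha> * (h u * threshold_rule first_best \<alpha> u)) =
      indicator {0..v} u * ((1 - cdf_of_density f u) * h u)" if u: "u \<in> {0..U}" for u
  proof -
    have "(LINT \<alpha>:{0..A}|lborel. f \<alpha> * (h u * threshold_rule first_best \<alpha> u)) =
        (LINT \<alpha>|density lborel f. indicator {0..A} \<alpha> * (h u * threshold_rule first_best \<alpha> u))"
      by (rule set_integral_type_density[OF f]) (simp add: threshold_rule_def)
    also have "\<dots> = (LINT \<alpha>|density lborel f. h u * indicator {0..v} u * indicator {u..} \<alpha>)"
    proof (rule integral_cong_AE)
      show "AE \<alpha> in density lborel f. indicator {0..A} \<alpha> * (h u * threshold_rule first_best \<alpha> u) =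
          h u * indicator {0..v} u * indicator {u..} \<alpha>"
        using AE_type_density_support[OF f] by eventually_elim
          (use u in \<open>auto simp: threshold_rule_def first_best_def\<close>)
    qed (auto simp: threshold_rule_def)
    also have "\<dots> = h u * indicator {0..v} u * (1 - cdf_of_density f u)"
      by (simp add: measure_type_density_atLeast[OF f])
    finally show ?thesis by simp
  qed
  have "(LINT z:rect|types. h (snd z) * threshold_rule first_best (fst z) (snd z)) =
      (LINT u:{0..U}|lborel. g u * (LINT \<alpha>:{0..A}|lborel. f \<alpha> * (h u * threshold_rule first_best \<alpha> u)))"
    using iterated_integral(2)[OF admissible_times[OF admissible_threshold(1) _ bd]] by simp
  also have "\<dots> = (LINT u:{0..U}|lborel. g u * (indicator {0..v} u * ((1 - cdf_of_density f u) * h u)))"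
    by (intro set_lebesgue_integral_cong) (auto simp: inner)
  \<comment> \<open>Since \<open>g\<close> vanishes above \<open>U\<close>, the range
    \<open>{0..v}\<close> is right whichever of \<open>U\<close> and \<open>v\<close> is
    larger.\<close>
  also have "\<dots> = (LINT u:{0..v}|lborel. (1 - cdf_of_density f u) * (g u * h u))"
    unfolding set_lebesgue_integral_def
    using g by (intro Bochner_Integration.integral_cong)
      (auto simp: type_density_def indicator_def)
  finally show ?thesis .
qed

text \<open>As \<open>first_best 0 = 0\<close>, the first best forces inspection of every allocated
  type with \<open>u > 0\<close>, that is of almost all of them.\<close>

lemma first_best_inspection:
  "(LINT z:rect|types. threshold_inspection first_best (fst z) (snd z)) =
    (LINT u:{0..v}|lborel. (1 - cdf_of_density f u) * g u)" (is "?lhs = ?rhs")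
  and first_best_inspection_pos: "0 < (LINT u:{0..v}|lborel. (1 - cdf_of_density f u) * g u)"
proof -
  have ae: "AE z in types. z \<in> rect \<and> snd z \<noteq> 0"
    using AE_types_rect AE_types_neq_graph[of "\<lambda>_. 0"] by auto
  have "?lhs = (LINT z:rect|types. threshold_rule first_best (fst z) (snd z))"
    unfolding set_lebesgue_integral_def
  proof (rule integral_cong_AE)
    show "AE z in types. indicator rect z *\<^sub>R threshold_inspection first_best (fst z) (snd z) =
        indicator rect z *\<^sub>R threshold_rule first_best (fst z) (snd z)"
      using ae by eventually_elim (auto simp: threshold_inspection_def threshold_rule_def)
  qed auto
  also have "\<dots> = ?rhs"
    using first_best_integral[of "\<lambda>_. 1" 1] by simp
  finally show *: "?lhs = ?rhs" .
  have int: "integrable types (\<lambda>z. indicator rect z *\<^sub>R threshold_inspection first_best (fst z) (snd z))"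
    using admissible_set_integrable(1)[OF admissible_threshold(2)[of first_best]]
    by (simp add: set_integrable_def)
  \<comment> \<open>Otherwise almost no type would be inspected, yet all types with
    \<open>0 < u < first_best \<alpha>\<close> are.\<close>
  have "?lhs \<noteq> 0"
  proof
    assume "?lhs = 0"
    then have "AE z in types. indicator rect z *\<^sub>R threshold_inspection first_best (fst z) (snd z) = 0"
      using int unfolding set_lebesgue_integral_def
      by (subst (asm) integral_nonneg_eq_0_iff_AE) (auto simp: threshold_inspection_def)
    then have "AE z in types. z \<in> rect \<and> threshold_inspection first_best (fst z) (snd z) = 0"
      using AE_types_rect by eventually_elim auto
    then have "AE \<alpha> in density lborel f. AE u in density lborel g.
        threshold_inspection first_best \<alpha> u = 0"
      using pair.AE_pair[of "\<lambda>z. z \<in> rect \<and> threshold_inspection first_best (fst z) (snd z) = 0"]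
      by auto
    then obtain \<alpha> where \<alpha>: "0 < \<alpha>" "\<alpha> < A"
        "AE u in density lborel g. threshold_inspection first_best \<alpha> u = 0"
      using AE_type_density_obtain[OF f _ order_refl A_pos order_refl] by blast
    obtain u where "0 < u" "u < first_best \<alpha>" "threshold_inspection first_best \<alpha> u = 0"
      using AE_type_density_obtain[OF g \<alpha>(3) order_refl, of "first_best \<alpha>"] \<alpha>(1) U_pos v_pos
      by (auto simp: first_best_def)
    then show False by (simp add: threshold_inspection_def)
  qed
  moreover have "0 \<le> ?lhs"
    unfolding set_lebesgue_integral_def
    by (intro Bochner_Integration.integral_nonneg) (auto simp: threshold_inspection_def)
  ultimately show "0 < ?rhs" using * by simp
qed

lemma first_best_revenue:
  "(LINT z:rect|types. virtual_type g (snd z) * threshold_rule first_best (fst z) (snd z)) =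
    (LINT u:{0..v}|lborel. (1 - cdf_of_density f u) * (1 - cdf_of_density g u - u * g u))"
  (is "?lhs = ?rhs")
  and first_best_revenue_nonneg:
  "0 \<le> (LINT u:{0..v}|lborel. (1 - cdf_of_density f u) * (1 - cdf_of_density g u - u * g u))"
proof -
  obtain B where B: "\<forall>u\<in>{0..U}. \<bar>virtual_type g u\<bar> \<le> B"
    using virtual_type_bounded[OF g U_pos] by metis
  have "?lhs = (LINT u:{0..v}|lborel. (1 - cdf_of_density f u) * (g u * virtual_type g u))"
    using first_best_integral[OF _ B] by simp
  also have "\<dots> = ?rhs"
  proof (intro set_lebesgue_integral_cong allI impI)
    \<comment> \<open>If \<open>v\<close> exceeds \<open>U\<close>, both sides vanish beyond
      \<open>U\<close>, where \<open>g\<close> is 0 and its c.d.f. is 1.\<close>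
    fix u assume "u \<in> {0..v}"
    then show "(1 - cdf_of_density f u) * (g u * virtual_type g u) =
        (1 - cdf_of_density f u) * (1 - cdf_of_density g u - u * g u)"
      using density_times_virtual_type[OF g, of u] cdf_of_density_eq_1[OF g, of u] g
      by (cases "u \<le> U") (auto simp: type_density_def)
  qed simp
  finally show *: "?lhs = ?rhs" .
  \<comment> \<open>For the sign the order is reversed: integrating over \<open>u\<close> first
    gives the posted-price revenue at \<open>first_best \<alpha>\<close>, which is
    nonnegative.\<close>
  have "?lhs = (LINT \<alpha>:{0..A}|lborel. f \<alpha> *
      (LINT u:{0..U}|lborel. g u * virtual_type g u * threshold_rule first_best \<alpha> u))"
    using revenue_eq[OF admissible_threshold(1)[of first_best]] by simp
  also have "\<dots> = (LINT \<alpha>:{0..A}|lborel. f \<alpha> * (first_best \<alpha> * (1 - cdf_of_density g (first_best \<alpha>))))"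
  proof (intro set_lebesgue_integral_cong allI impI)
    fix \<alpha> assume "\<alpha> \<in> {0..A}"
    then have fb: "first_best \<alpha> \<in> {0..U}"
      using U_pos v_pos by (auto simp: first_best_def)
    have "(LINT u:{0..U}|lborel. g u * virtual_type g u * threshold_rule first_best \<alpha> u) =
        (LINT u:{0..first_best \<alpha>}|lborel. g u * virtual_type g u)"
      unfolding set_lebesgue_integral_def using fb
      by (intro Bochner_Integration.integral_cong) (auto simp: threshold_rule_def indicator_def)
    then show "f \<alpha> * (LINT u:{0..U}|lborel. g u * virtual_type g u * threshold_rule first_best \<alpha> u) =
        f \<alpha> * (first_best \<alpha> * (1 - cdf_of_density g (first_best \<alpha>)))"
      using virtual_type_integral[OF g fb] by simp
  qed simp
  also have "\<dots> \<ge> 0"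
    unfolding set_lebesgue_integral_def
    using type_density_nonneg[OF f] cdf_of_density_bounds(2)[OF g] U_pos v_pos
    by (intro Bochner_Integration.integral_nonneg) (auto simp: first_best_def indicator_def)
  finally show "0 \<le> ?rhs" using * by simp
qed

text \<open>This makes \<open>K\<close> positive, so that excess inspection costs money.\<close>

lemma K_low_nonneg: "0 \<le> K_low v f g"
  unfolding K_low_def using first_best_revenue_nonneg first_best_inspection_pos
  by (intro divide_nonneg_pos)

text \<open>\<open>K_low\<close> is the break-even inspection cost of the first best: its revenue
  divided by its amount of inspection.\<close>

lemma net_revenue_first_best_neg:
  assumes "K_low v f g < K"
  shows "net_revenue K first_best < 0"
  using assms first_best_inspection_pos
  by (simp add: net_revenue_def first_best_revenue first_best_inspection K_low_def divide_less_eq)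

text \<open>The surplus \<open>min v \<alpha> - u\<close> changes sign at the first best, so moving \<open>\<phi>\<close> pointwise
  towards it gains at every type whose allocation changes.\<close>

lemma threshold_improvable:
  assumes [measurable]: "\<phi> \<in> borel_measurable borel"
    and range: "\<And>\<alpha>. \<alpha> \<in> {0..A} \<Longrightarrow> \<phi> \<alpha> \<in> {0..U}"
    and low: "\<And>\<alpha>. \<alpha> \<in> {0..A} \<Longrightarrow> \<phi> 0 \<le> \<phi> \<alpha>"
    and "K_low v f g < K" "0 < net_revenue K \<phi>"
  obtains a c where "feasible A U K f g a c"
    "objective A U v f g (\<lambda>\<alpha> u. \<alpha>) (threshold_rule \<phi>) < objective A U v f g (\<lambda>\<alpha> u. \<alpha>) a"
proof -
  define p where "p s = (\<lambda>\<alpha>. (1 - s) * \<phi> \<alpha> + s * first_best \<alpha>)" for s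
  have [measurable]: "p s \<in> borel_measurable borel" for s by (simp add: p_def)
  have "net_revenue K (p 1) \<le> 0" "0 \<le> net_revenue K (p 0)"
    using net_revenue_first_best_neg[OF assms(4)] assms(5) by (simp_all add: p_def)
  moreover have "continuous_on {0..1} (\<lambda>s. net_revenue K (p s))"
    unfolding p_def by (intro net_revenue_path_continuous) auto
  ultimately obtain s where s: "0 \<le> s" "s \<le> 1" "net_revenue K (p s) = 0"
    using IVT2'[of "\<lambda>s. net_revenue K (p s)" 1 0 0] by auto
  have "s \<noteq> 0" using s(3) assms(5) by (auto simp: p_def)
  have p_range: "p s \<alpha> \<in> {0..U}" "p s 0 \<le> p s \<alpha>" if "\<alpha> \<in> {0..A}" for \<alpha>
  proof -
    have fb: "first_best \<alpha> \<in> {0..U}" using that U_pos v_pos by (auto simp: first_best_def)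
    then have "p s \<alpha> \<in> {0..U}"
      using s range[OF that] convex_bound_le[of "\<phi> \<alpha>" U "first_best \<alpha>" "1 - s" s]
      by (auto simp: p_def)
    moreover have "p s 0 \<le> p s \<alpha>"
      using s fb low[OF that] unfolding p_def by (intro add_mono mult_left_mono) auto
    ultimately show "p s \<alpha> \<in> {0..U}" "p s 0 \<le> p s \<alpha>" by auto
  qed
  \<comment> \<open>The pointwise change of surplus when the threshold moves from
    \<open>\<phi>\<close> to \<open>p s\<close>.\<close>
  define gain where "gain = (\<lambda>z. indicator rect z *\<^sub>R ((min v (fst z) - snd z) * threshold_rule (p s) (fst z) (snd z))
      - indicator rect z *\<^sub>R ((min v (fst z) - snd z) * threshold_rule \<phi> (fst z) (snd z)))"
  have int: "integrable types (\<lambda>z. indicator rect z *\<^sub>R ((min v (fst z) - snd z) * threshold_rule q (fst z) (snd z)))"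
    if "q \<in> borel_measurable borel" for q
    using admissible_set_integrable(2)[OF admissible_threshold(1)[OF that]]
    by (simp add: set_integrable_def)
  have gain_eq: "objective A U v f g (\<lambda>\<alpha> u. \<alpha>) (threshold_rule (p s)) -
      objective A U v f g (\<lambda>\<alpha> u. \<alpha>) (threshold_rule \<phi>) = integral\<^sup>L types gain"
    using int[of "p s"] int[of \<phi>]
    by (simp add: objective_eq admissible_threshold gain_def set_lebesgue_integral_def)
  have gain_int: "integrable types gain"
    unfolding gain_def using int[of "p s"] int[of \<phi>] by simp
  \<comment> \<open>On the graph \<open>u = min v \<alpha>\<close> the surplus is 0, so there the
    allocation may change without a gain.\<close>
  have gain_cases: "0 \<le> gain z" "gain z = 0 \<Longrightarrow> z \<in> rect \<Longrightarrow> snd z \<noteq> min v (fst z) \<Longrightarrow>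
    threshold_rule (p s) (fst z) (snd z) = threshold_rule \<phi> (fst z) (snd z)" for z
  proof -
    obtain \<alpha> u where z: "z = (\<alpha>, u)" by force
    \<comment> \<open>\<open>p s - \<phi>\<close> and \<open>first_best - p s\<close> are the
      multiples of \<open>first_best - \<phi>\<close> by \<open>s\<close> and \<open>1 - s\<close>,
      so the threshold never overshoots the first best.\<close>
    have up: "u \<le> min v \<alpha>" if "\<phi> \<alpha> < u" "u \<le> p s \<alpha>"
    proof -
      have "0 < s * (first_best \<alpha> - \<phi> \<alpha>)" using that by (simp add: p_def algebra_simps)
      then have "0 \<le> (1 - s) * (first_best \<alpha> - \<phi> \<alpha>)"
        using s by (simp add: zero_less_mult_iff)
      then have "p s \<alpha> \<le> first_best \<alpha>" by (simp add: p_def algebra_simps)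
      then show ?thesis using that by (simp add: first_best_def)
    qed
    \<comment> \<open>Here \<open>u \<le> U\<close> matters: it removes the cut at \<open>U\<close>
      in \<open>first_best\<close>.\<close>
    have down: "min v \<alpha> < u" if "u \<le> \<phi> \<alpha>" "p s \<alpha> < u" "u \<le> U"
    proof -
      have "0 < s * (\<phi> \<alpha> - first_best \<alpha>)" using that by (simp add: p_def algebra_simps)
      then have "0 \<le> (1 - s) * (\<phi> \<alpha> - first_best \<alpha>)"
        using s by (simp add: zero_less_mult_iff)
      then have "first_best \<alpha> \<le> p s \<alpha>" by (simp add: p_def algebra_simps)
      then show ?thesis using that by (auto simp: first_best_def)
    qed
    show "0 \<le> gain z"
      using up down by (auto simp: z gain_def threshold_rule_def split: split_indicator)
    show "threshold_rule (p s) (fst z) (snd z) = threshold_rule \<phi> (fst z) (snd z)"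
      if "gain z = 0" "z \<in> rect" "snd z \<noteq> min v (fst z)"
      using that by (auto simp: z gain_def simp flip: right_diff_distrib)
  qed
  have "integral\<^sup>L types gain \<noteq> 0"
  proof
    assume "integral\<^sup>L types gain = 0"
    then have "AE z in types. gain z = 0"
      using integral_nonneg_eq_0_iff_AE[OF gain_int] gain_cases(1) by simp
    moreover have "AE z in types. snd z \<noteq> min v (fst z)"
      by (intro AE_types_neq_graph) simp
    ultimately have ae: "AE z in types.
        threshold_rule (p s) (fst z) (snd z) = threshold_rule \<phi> (fst z) (snd z)"
      using AE_types_rect by eventually_elim (rule gain_cases(2))
    then have sections: "AE \<alpha> in density lborel f. AE u in density lborel g.
        threshold_rule (p s) \<alpha> u = threshold_rule \<phi> \<alpha> u"
      using pair.AE_pair[OF ae] by simp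
    \<comment> \<open>Different thresholds in \<open>{0..U}\<close> disagree on the whole interval
      between them, which has positive mass.\<close>
    have section_eq: "p s \<alpha> = \<phi> \<alpha>" if \<alpha>: "\<alpha> \<in> {0..A}"
      and eq: "AE u in density lborel g. threshold_rule (p s) \<alpha> u = threshold_rule \<phi> \<alpha> u" for \<alpha>
    proof (rule ccontr)
      assume "p s \<alpha> \<noteq> \<phi> \<alpha>"
      then have "0 \<le> min (p s \<alpha>) (\<phi> \<alpha>)" "min (p s \<alpha>) (\<phi> \<alpha>) < max (p s \<alpha>) (\<phi> \<alpha>)"
        "max (p s \<alpha>) (\<phi> \<alpha>) \<le> U"
        using range[OF \<alpha>] p_range(1)[OF \<alpha>] by auto
      from AE_type_density_obtain[OF g eq this] obtain u where "min (p s \<alpha>) (\<phi> \<alpha>) < u" "u < max (p s \<alpha>) (\<phi> \<alpha>)"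
          "threshold_rule (p s) \<alpha> u = threshold_rule \<phi> \<alpha> u"
        by blast
      then show False by (auto simp: threshold_rule_def split: if_splits)
    qed
    from sections have ae': "AE \<alpha> in density lborel f. p s \<alpha> = \<phi> \<alpha>"
      using AE_type_density_support[OF f] by eventually_elim (rule section_eq)
    \<comment> \<open>Net revenue needs equality at the point 0 itself. If \<open>\<phi> 0\<close>
      were positive, some positive \<open>\<alpha> < \<phi> 0\<close> would have
      \<open>p s \<alpha> = \<phi> \<alpha>\<close>, hence \<open>\<phi> \<alpha> = first_best
      \<alpha> \<le> \<alpha> < \<phi> 0\<close>, against the minimality of \<open>\<phi> 0\<close>.
      So \<open>\<phi> 0 = 0 = first_best 0\<close>.\<close>
    have "\<phi> 0 \<le> 0"
    proof (rule ccontr)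
      assume pos: "\<not> \<phi> 0 \<le> 0"
      then obtain \<alpha> where \<alpha>: "0 < \<alpha>" "\<alpha> < min A (\<phi> 0)" "p s \<alpha> = \<phi> \<alpha>"
        using AE_type_density_obtain[OF f ae', of 0 "min A (\<phi> 0)"] A_pos by auto
      then have "s * (first_best \<alpha> - \<phi> \<alpha>) = 0" by (simp add: p_def algebra_simps)
      then have "\<phi> \<alpha> \<le> \<alpha>" using \<open>s \<noteq> 0\<close> by (simp add: first_best_def)
      then show False using low[of \<alpha>] \<alpha> by auto
    qed
    then have "p s 0 = \<phi> 0" using range[of 0] A_pos by (simp add: p_def)
    then have "net_revenue K (p s) = net_revenue K \<phi>"
      by (intro net_revenue_cong ae) auto
    then show False using s(3) assms(5) by simp
  qed
  moreover have "0 \<le> integral\<^sup>L types gain"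
    using gain_cases(1) by simp
  ultimately have "objective A U v f g (\<lambda>\<alpha> u. \<alpha>) (threshold_rule \<phi>) <
      objective A U v f g (\<lambda>\<alpha> u. \<alpha>) (threshold_rule (p s))"
    using gain_eq by simp
  moreover have "feasible A U K f g (threshold_rule (p s)) (threshold_inspection (p s))"
    using p_range(2) s(3) by (intro feasible_threshold) auto
  ultimately show ?thesis by (rule that[rotated])
qed

section \<open>Optimal inspection for a threshold allocation\<close>

text \<open>Excess inspection is nonnegative pointwise and has integral 0 by optimality, so it
  vanishes almost everywhere. Hence the least inspection also meets the budget, and replacing
  \<open>c\<close> by it leaves the objective unchanged.\<close>

lemma optimal_threshold_inspection:
  assumes [measurable]: "\<phi> \<in> borel_measurable borel"
    and range: "\<And>\<alpha>. \<alpha> \<in> {0..A} \<Longrightarrow> \<phi> \<alpha> \<in> {0..U}"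
    and low: "\<And>\<alpha>. \<alpha> \<in> {0..A} \<Longrightarrow> \<phi> 0 \<le> \<phi> \<alpha>"
    and K: "K_low v f g < K"
    and opt: "optimal A U v K f g (\<lambda>\<alpha> u. \<alpha>) a c"
    and a: "\<And>\<alpha> u. \<alpha> \<in> {0..A} \<Longrightarrow> u \<in> {0..U} \<Longrightarrow> a \<alpha> u = threshold_rule \<phi> \<alpha> u"
  shows "AE z in lborel. z \<in> rect \<longrightarrow> c (fst z) (snd z) = threshold_inspection \<phi> (fst z) (snd z)"
    and "optimal A U v K f g (\<lambda>\<alpha> u. \<alpha>) a (threshold_inspection \<phi>)"
proof -
  define slack where "slack = (\<lambda>z. indicator rect z *\<^sub>R c (fst z) (snd z) -
    indicator rect z *\<^sub>R threshold_inspection \<phi> (fst z) (snd z))"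
  have feas: "feasible A U K f g a c"
    and best: "\<And>a' c'. feasible A U K f g a' c' \<Longrightarrow>
      objective A U v f g (\<lambda>\<alpha> u. \<alpha>) a' \<le> objective A U v f g (\<lambda>\<alpha> u. \<alpha>) a"
    using opt by (auto simp: optimal_def)
  then have adm: "admissible_rule A U a" "admissible_rule A U c"
    by (auto simp: feasible_def)
  note adm' = admissible_threshold[OF assms(1)]
  have rect_eq: "(LINT z:rect|types. h z * a (fst z) (snd z)) =
      (LINT z:rect|types. h z * threshold_rule \<phi> (fst z) (snd z))" for h
    unfolding set_lebesgue_integral_def
    using a by (intro Bochner_Integration.integral_cong refl) (auto split: split_indicator)
  have budget: "(LINT z:rect|types. virtual_type g (snd z) * threshold_rule \<phi> (fst z) (snd z)) =
      K * (LINT z:rect|types. c (fst z) (snd z))"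
    using feas unfolding feasible_def revenue_eq[OF adm(1)] inspection_eq[OF adm(2)] rect_eq by blast
  have obj: "objective A U v f g (\<lambda>\<alpha> u. \<alpha>) a = objective A U v f g (\<lambda>\<alpha> u. \<alpha>) (threshold_rule \<phi>)"
    by (simp add: objective_eq adm(1) adm'(1) rect_eq)
  have int: "integrable types (\<lambda>z. indicator rect z *\<^sub>R c (fst z) (snd z))"
    "integrable types (\<lambda>z. indicator rect z *\<^sub>R threshold_inspection \<phi> (fst z) (snd z))"
    using admissible_set_integrable(1)[OF adm(2)] admissible_set_integrable(1)[OF adm'(2)]
    by (simp_all add: set_integrable_def)
  have slack_int: "integrable types slack"
    unfolding slack_def using int by simp
  \<comment> \<open>The budget of the optimal pair replaces revenue by the cost of \<open>c\<close>;
    what remains is the cost of the excess inspection.\<close>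
  have net: "net_revenue K \<phi> = K * integral\<^sup>L types slack"
    using int unfolding net_revenue_def budget
    by (simp add: slack_def set_lebesgue_integral_def right_diff_distrib)
  \<comment> \<open>Where \<open>\<phi> 0 < u \<le> \<phi> \<alpha>\<close> the constraint reads
    \<open>1 - c \<alpha> u \<le> 0\<close>; elsewhere \<open>0 \<le> c \<alpha> u\<close>
    suffices.\<close>
  have slack_nonneg: "0 \<le> slack z" for z
  proof (cases "z \<in> rect")
    case True
    then have z: "fst z \<in> {0..A}" "snd z \<in> {0..U}" by auto
    have 0: "(0::real) \<in> {0..A}" using A_pos by simp
    have "a (fst z) (snd z) - a (fst z) (snd z) * c (fst z) (snd z) \<le> a 0 (snd z)"
      "0 \<le> c (fst z) (snd z)"
      using feas z by (auto simp: feasible_def admissible_rule_iff)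
    then have "threshold_inspection \<phi> (fst z) (snd z) \<le> c (fst z) (snd z)"
      using a[OF z] a[OF 0 z(2)] by (auto simp: threshold_rule_def threshold_inspection_def)
    then show ?thesis using True by (simp add: slack_def)
  qed (simp add: slack_def)
  have slack_0: "integral\<^sup>L types slack = 0"
  proof (rule ccontr)
    assume "integral\<^sup>L types slack \<noteq> 0"
    moreover have "0 \<le> integral\<^sup>L types slack" using slack_nonneg by simp
    ultimately have "0 < net_revenue K \<phi>" using K K_low_nonneg by (simp add: net)
    then obtain a' c' where "feasible A U K f g a' c'"
      "objective A U v f g (\<lambda>\<alpha> u. \<alpha>) (threshold_rule \<phi>) < objective A U v f g (\<lambda>\<alpha> u. \<alpha>) a'"
      using threshold_improvable[OF assms(1) range low K] by blast
    then show False using best obj by (metis not_less)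
  qed
  then have "AE z in types. slack z = 0"
    using integral_nonneg_eq_0_iff_AE[OF slack_int] slack_nonneg by simp
  then have "AE z in lborel. z \<in> rect \<longrightarrow> slack z = 0"
    using borel_measurable_integrable[OF slack_int] by (subst (asm) AE_types_iff) auto
  then show "AE z in lborel. z \<in> rect \<longrightarrow> c (fst z) (snd z) = threshold_inspection \<phi> (fst z) (snd z)"
    by eventually_elim (auto simp: slack_def)
  have "feasible A U K f g (threshold_rule \<phi>) (threshold_inspection \<phi>)"
    using low net slack_0 by (intro feasible_threshold) auto
  \<comment> \<open>Feasibility depends only on values on the rectangle, where \<open>a\<close> is
    the threshold rule.\<close>
  then have "feasible A U K f g a (threshold_inspection \<phi>)"
    using a adm(1) A_pos
    by (auto simp: feasible_def revenue_eq adm adm' rect_eq)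
  then show "optimal A U v K f g (\<lambda>\<alpha> u. \<alpha>) a (threshold_inspection \<phi>)"
    using best by (simp add: optimal_def)
qed

end

section \<open>The thresholds \<open>phi\<close> and \<open>psi\<close>\<close>

lemma phi_eq:
  assumes "u_bot \<le> u_top"
  shows "phi v u_bot u_top \<alpha> = max u_bot (min u_top (\<alpha> - (v - u_top)))"
  using assms by (auto simp: phi_def)

text \<open>The assumptions on the constants give \<open>phi v u_bot u_top 0 = u_bot\<close>. Above
  \<open>u_bot\<close>, \<open>phi\<close> and \<open>psi\<close> differ only where neither rule
  inspects, and off the curve strict and weak inequality agree.\<close>

lemma threshold_inspection_eq_inspection_rule:
  assumes "0 \<le> u_bot" "u_bot \<le> u_top" "u_top \<le> v" "0 < v" "u \<in> {0..U}" "u \<noteq> psi v u_bot u_top \<alpha>"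
  shows "threshold_inspection (\<lambda>\<alpha>. min U (phi v u_bot u_top \<alpha>)) \<alpha> u = inspection_rule v u_bot u_top \<alpha> u"
  using assms
  by (auto simp: threshold_inspection_def inspection_rule_def phi_def psi_def split: if_splits)

theorem corollary1:
  fixes A U v K u_bot u_top :: real
    and f g :: "real \<Rightarrow> real"
    and a c :: "real \<Rightarrow> real \<Rightarrow> real"
  assumes "0 < A" and "0 < U" and "0 < v"
    and "type_density A f" and "type_density U g"
    and "antimono_on {0..U} (virtual_type g)"
    and "K_low v f g < K"
    and "0 \<le> u_bot" and "u_bot \<le> u_top" and "u_top \<le> v"
    and "optimal A U v K f g (\<lambda>\<alpha> u. \<alpha>) a c"
    and "\<forall>\<alpha>\<in>{0..A}. \<forall>u\<in>{0..U}. a \<alpha> u = allocation_rule v u_bot u_top \<alpha> u"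
  shows "(AE (\<alpha>, u) in lborel. \<alpha> \<in> {0..A} \<and> u \<in> {0..U} \<longrightarrow>
            c \<alpha> u = inspection_rule v u_bot u_top \<alpha> u) \<and>
         (\<exists>c'. optimal A U v K f g (\<lambda>\<alpha> u. \<alpha>) a c' \<and>
            (\<forall>\<alpha>\<in>{0..A}. \<forall>u\<in>{0..U}. u \<noteq> psi v u_bot u_top \<alpha> \<longrightarrow>
               c' \<alpha> u = inspection_rule v u_bot u_top \<alpha> u))"
proof -
  interpret regulator A U v f g using assms by unfold_locales
  \<comment> \<open>\<open>u_top\<close> may exceed \<open>U\<close>, so the threshold is cut at
    \<open>U\<close>; the allocation on the rectangle is unaffected.\<close>
  define \<phi> where "\<phi> = (\<lambda>\<alpha>. min U (phi v u_bot u_top \<alpha>))"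
  \<comment> \<open>The max-min form makes measurability and monotonicity in \<open>\<alpha>\<close>
    immediate.\<close>
  note phi = phi_eq[OF assms(9), of v]
  have \<phi>: "\<phi> \<in> borel_measurable borel"
    unfolding \<phi>_def phi by measurable
  have range: "\<phi> \<alpha> \<in> {0..U}" "\<phi> 0 \<le> \<phi> \<alpha>" if "\<alpha> \<in> {0..A}" for \<alpha>
    using that assms(2,8,9) by (auto simp: \<phi>_def phi)
  have a: "a \<alpha> u = threshold_rule \<phi> \<alpha> u" if "\<alpha> \<in> {0..A}" "u \<in> {0..U}" for \<alpha> u
    using assms(12) that by (auto simp: \<phi>_def threshold_rule_def allocation_rule_def)
  have inspection: "AE z in lborel. z \<in> rect \<longrightarrow> c (fst z) (snd z) = threshold_inspection \<phi> (fst z) (snd z)"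
    "optimal A U v K f g (\<lambda>\<alpha> u. \<alpha>) a (threshold_inspection \<phi>)"
    by (rule optimal_threshold_inspection[OF \<phi> _ _ assms(7,11)]; fact range a)+
  have eq: "threshold_inspection \<phi> \<alpha> u = inspection_rule v u_bot u_top \<alpha> u"
    if "u \<in> {0..U}" "u \<noteq> psi v u_bot u_top \<alpha>" for \<alpha> u
    unfolding \<phi>_def using assms that by (intro threshold_inspection_eq_inspection_rule) auto
  \<comment> \<open>The least inspection and the stated rule can differ on the rectangle only on the
    graph of \<open>psi\<close>, a null set.\<close>
  have "psi v u_bot u_top \<in> borel_measurable borel"
    unfolding psi_def by measurable
  then have "AE z in lborel \<Otimes>\<^sub>M lborel. snd z \<noteq> psi v u_bot u_top (fst z)"
    by (intro AE_pair_neq_graph lborel_pair.pair_sigma_finite_axioms) (auto intro: AE_lborel_singleton)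
  then have "AE z in lborel. snd z \<noteq> psi v u_bot u_top (fst z)"
    unfolding lborel_prod .
  with inspection(1) have "AE (\<alpha>, u) in lborel. \<alpha> \<in> {0..A} \<and> u \<in> {0..U} \<longrightarrow>
      c \<alpha> u = inspection_rule v u_bot u_top \<alpha> u"
    by eventually_elim (auto simp: eq)
  \<comment> \<open>The witness for \<open>c'\<close> is
    \<open>threshold_inspection \<phi>\<close>.\<close>
  with inspection(2) eq show ?thesis by blast
qed

end
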